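(* Let $\mathcal Z$ be a zigzag and let $\underline{c}$ be a permissible function with $\underline{c}(X)>0$ for every $X\in\mathrm{Ind}(\mathcal C_{\mathcal Z})$. Then the continuous associahedron $\mathbb U_{\mathcal Z,\underline{c}}$ is a convex subset of $\prod_{\mathrm{Ind}(\mathcal C_{\mathcal Z})}\mathbb R$; that is, any line segment in $\prod_{\mathrm{Ind}(\mathcal C_{\mathcal Z})}\mathbb R$ whose endpoints are in $\mathbb U_{\mathcal Z,\underline{c}}$ is entirely contained in $\mathbb U_{\mathcal Z,\underline{c}}$.
   Context: Indecomposables. $\mathrm{Ind}(\mathcal D)$ is the open strip $\mathbb R\times(-\frac{\pi}{2},\frac{\pi}{2})$ (its points are the indecomposable objects of a triangulated category $\mathcal D$), $0$ is the zero object, and every point on the lines $y=\pm\frac{\pi}{2}$ is read as $0$. The shift is $(x,y)[1]:=(x+\pi,-y)$. Tilting rectangle. Let $X=(x,y)\in\mathrm{Ind}(\mathcal D)$ and let $a,b$ be reals with $0<a\le\frac{\pi}{2}-y$, $0<b\le y+\frac{\pi}{2}$. Put $Y=(x+a,y+a)$, $Z=(x+b,y-b)$, $W=(x+a+b,y+a-b)$. The rectangle $XYWZ$ is a tilting rectangle with left, top, right, bottom corners $X,Y,W,Z$ ($Y$ or $Z$ may lie on $y=\pm\frac{\pi}{2}$, and is then read as $0$). Zigzag. Let $\ell_1,\dots,\ell_n$ be distinct line segments in $\mathbb R\times[-\frac{\pi}{2},\frac{\pi}{2}]$ such that $\ell_1$ has slope $\pm1$ and its top point lies on $y=\frac{\pi}{2}$;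 for $1\le i<n$, $\ell_{i+1}$ lies below $\ell_i$ and they meet at a right angle (sharing one endpoint); the bottom point of $\ell_n$ lies on $y=-\frac{\pi}{2}$. The zigzag is $\mathcal Z=(\bigcup_i\ell_i)\cap(\mathbb R\times(-\frac{\pi}{2},\frac{\pi}{2}))$. It meets each horizontal line $y=\text{const}$ in the open strip in exactly one point $(z(y),y)$. $\mathcal Z[1]$ is the set of shifts of points of $\mathcal Z$. $\mathrm{Ind}(\mathcal C_{\mathcal Z})$ is the set of points lying between $\mathcal Z$ and $\mathcal Z[1]$ inclusive: $\{(x,y)\in\mathrm{Ind}(\mathcal D): z(y)\le x\le z(-y)+\pi\}$. Permissible function. $\underline c:\mathrm{Ind}(\mathcal D)\sqcup\{0\}\to\mathbb R$ with $\underline c(0)=0$ such that for every tilting rectangle $XYWZ$ the surface integral $\int_{XYWZ}\underline c$ over the region it bounds yields a real number. Solution. A solution with respect to $\underline c$ in $\mathcal C_{\mathcal Z}$ is a function $\Phi:\mathrm{Ind}(\mathcal D)\sqcup\{0\}\to\mathbb R$ with $\Phi(0)=0$ such that $\Phi(X)+\Phi(W)=\Phi(Y)+\Phi(Z)+\int_{XYWZ}\underline c$ for every tilting rectangle $XYWZ$ (continuous deformed mesh relations over $\underline c$) and $\Phi(X)\ge0$ for all $X\in\mathrm{Ind}(\mathcal C_{\mathcal Z})$. Continuous associahedron. $\mathbb U_{\mathcal Z,\underline c}\subset\prod_{\mathrm{Ind}(\mathcal C_{\mathcal Z})}\mathbb R$ is the set of vectors $(\Phi(X))_{X\in\mathrm{Ind}(\mathcal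 C_{\mathcal Z})}$ for $\Phi$ a solution with respect to $\underline c$ in $\mathcal C_{\mathcal Z}$. *)

theory Defs
  imports "HOL-Analysis.Analysis" "HOL-Library.Function_Algebras"
begin

text \<open>Pointwise real vector space structure on functions; the additive group structure is the one
  of \<^theory>\<open>HOL-Library.Function_Algebras\<close>.\<close>

instantiation "fun" :: (type, real_vector) real_vector
begin

definition scaleR_fun :: "real \<Rightarrow> ('a \<Rightarrow> 'b) \<Rightarrow> 'a \<Rightarrow> 'b" where
  "scaleR_fun r f = (\<lambda>x. r *\<^sub>R f x)"

instance
  by standard (auto simp: scaleR_fun_def fun_eq_iff algebra_simps)

end

definition Ind_D :: "(real \<times> real) set" where
  "Ind_D = UNIV \<times> {- (pi/2) <..< pi/2}"

text \<open>The objects in the union of \<open>Ind_D\<close> and the zero object are encoded in the option type: \<open>None\<close> is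
  the zero object and \<open>Some X\<close> with \<open>X \<in> Ind_D\<close> is the indecomposable \<open>X\<close>. Values of functions at
  \<open>Some X\<close> with \<open>X \<notin> Ind_D\<close> are never used. A point on one of the lines \<open>y = \<plusminus> pi/2\<close> is read as the
  zero object.\<close>

type_synonym object = "(real \<times> real) option"

definition object_of :: "real \<times> real \<Rightarrow> object" where
  "object_of X = (if X \<in> Ind_D then Some X else None)"

text \<open>The arguments are the left, top, right and bottom corner, in this order.\<close>

definition tilting_rectangle ::
  "real \<times> real \<Rightarrow> real \<times> real \<Rightarrow> real \<times> real \<Rightarrow> real \<times> real \<Rightarrow> bool" where
  "tilting_rectangle X Y W Z \<longleftrightarrow>
     (\<exists>x y a b. (x, y) \<in> Ind_D \<and> 0 < a \<and> a \<le> pi/2 - y \<and> 0 < b \<and> b \<le> y + pi/2 \<and>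
        X = (x, y) \<and> Y = (x + a, y + a) \<and> Z = (x + b, y - b) \<and> W = (x + a + b, y + a - b))"

text \<open>The segment \<open>l i\<close> has top point \<open>T i\<close> and bottom point \<open>B i\<close>; none of the segments is horizontal,
  since the slopes are all \<open>\<plusminus>1\<close>. That \<open>l (Suc i)\<close> lies below \<open>l i\<close> and shares an endpoint with it means
  that the bottom point of \<open>l i\<close> is the top point of \<open>l (Suc i)\<close>.\<close>

definition zigzag :: "(real \<times> real) set \<Rightarrow> bool" where
  "zigzag \<Z> \<longleftrightarrow>
     (\<exists>n T B l. 1 \<le> n \<and>
        (\<forall>i\<in>{1..n}. l i = closed_segment (T i) (B i) \<and> snd (B i) < snd (T i) \<and>
                     l i \<subseteq> UNIV \<times> {- (pi/2)..pi/2}) \<and>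
        inj_on l {1..n::nat} \<and>
        (snd (T 1) - snd (B 1)) / (fst (T 1) - fst (B 1)) \<in> {1, -1} \<and>
        snd (T 1) = pi/2 \<and>
        (\<forall>i\<in>{1..<n}. B i = T (Suc i) \<and> orthogonal (T i - B i) (T (Suc i) - B (Suc i))) \<and>
        snd (B n) = - (pi/2) \<and>
        \<Z> = (\<Union>i\<in>{1..n}. l i) \<inter> Ind_D)"

lemma zigzag_unique_point:
  assumes "zigzag \<Z>" and y: "y \<in> {- (pi/2) <..< pi/2}"
  shows "\<exists>!x. (x, y) \<in> \<Z>"
proof -
  obtain n T B l where n: "1 \<le> n"
    and l: "\<And>i. i \<in> {1..n} \<Longrightarrow> l i = closed_segment (T i) (B i)"
    and down: "\<And>i. i \<in> {1..n} \<Longrightarrow> snd (B i) < snd (T i)"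
    and T1: "snd (T 1) = pi/2" and link: "\<And>i. i \<in> {1..<n} \<Longrightarrow> B i = T (Suc i)"
    and Bn: "snd (B n) = - (pi/2)" and \<Z>: "\<Z> = (\<Union>i\<in>{1..n::nat}. l i) \<inter> Ind_D"
    using assms(1) unfolding zigzag_def by (elim exE conjE) (rule that, assumption, blast+)
  have seg: "snd b \<le> snd p \<and> snd p \<le> snd t \<and> (q \<in> closed_segment t b \<and> snd p = snd q \<longrightarrow> p = q)"
    if p: "p \<in> closed_segment t b" "snd b < snd t" for t b p q :: "real \<times> real"
  proof -
    obtain u where u: "p = (1 - u) *\<^sub>R t + u *\<^sub>R b" "0 \<le> u" "u \<le> 1"
      using p(1) unfolding closed_segment_def by blast
    have sp: "snd p = snd t - u * (snd t - snd b)"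
      unfolding u(1) by (simp add: algebra_simps)
    have "0 \<le> u * (snd t - snd b)" "u * (snd t - snd b) \<le> 1 * (snd t - snd b)"
      using u p by (auto intro!: mult_right_mono)
    moreover have "p = q" if q: "q \<in> closed_segment t b" "snd p = snd q"
    proof -
      obtain v where v: "q = (1 - v) *\<^sub>R t + v *\<^sub>R b"
        using q(1) unfolding closed_segment_def by blast
      have "snd q = snd t - v * (snd t - snd b)"
        unfolding v by (simp add: algebra_simps)
      then have "u = v"
        using sp q \<open>snd b < snd t\<close> by simp
      then show ?thesis using u v by simp
    qed
    ultimately show ?thesis using sp by auto
  qed
  have order: "snd (T (i + Suc k)) \<le> snd (B i) \<and> (0 < k \<longrightarrow> snd (T (i + Suc k)) < snd (B i))"
    if "1 \<le> i" "i + Suc k \<le> n" for i k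
    using that
  proof (induction k)
    case 0
    then show ?case using link[of i] by simp
  next
    case (Suc k)
    then show ?case
      using link[of "i + Suc k"] down[of "i + Suc k"] by fastforce
  qed
  define i where "i = (LEAST i. 1 \<le> i \<and> snd (B i) \<le> y)"
  have i: "1 \<le> i \<and> snd (B i) \<le> y"
    unfolding i_def by (rule LeastI[of _ n]) (use n Bn y in auto)
  have "i \<le> n"
    unfolding i_def by (rule Least_le) (use n Bn y in auto)
  have "y \<le> snd (T i)"
  proof (cases "i = 1")
    case False
    then have "\<not> snd (B (i - 1)) \<le> y"
      using not_less_Least[of "i - 1" "\<lambda>i. 1 \<le> i \<and> snd (B i) \<le> y", folded i_def] i
      by linarith
    moreover have "B (i - 1) = T i"
      using link[of "i - 1"] False i \<open>i \<le> n\<close> by (cases i) auto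
    ultimately show ?thesis by simp
  qed (use T1 y in auto)
  define u where "u = (snd (T i) - y) / (snd (T i) - snd (B i))"
  have Bi: "snd (B i) < snd (T i)" using down i \<open>i \<le> n\<close> by simp
  have "u * (snd (T i) - snd (B i)) = snd (T i) - y" using Bi by (simp add: u_def)
  then have "snd ((1 - u) *\<^sub>R T i + u *\<^sub>R B i) = y" by (simp add: algebra_simps)
  moreover have "0 \<le> u" "u \<le> 1" using Bi i \<open>y \<le> snd (T i)\<close> by (auto simp: u_def)
  moreover have "l i = closed_segment (T i) (B i)" using l i \<open>i \<le> n\<close> by simp
  ultimately have "\<exists>p. p \<in> l i \<and> snd p = y"
    unfolding closed_segment_def by blast
  then have ex: "\<exists>x. (x, y) \<in> \<Z>"
    using i \<open>i \<le> n\<close> y by (force simp: \<Z> Ind_D_def)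
  have uniq: "p = q"
    if p: "p \<in> l i" "snd p = y" and q: "q \<in> l j" "snd q = y"
      and ij: "1 \<le> i" "i \<le> j" "j \<le> n" for p q i j
  proof (cases "i = j")
    case True
    then show ?thesis using p q ij seg[of p "T i" "B i" q] l[of i] down[of i] by auto
  next
    case False
    then obtain k where k: "j = i + Suc k"
      using ij by (metis add_Suc_right less_imp_Suc_add le_neq_implies_less)
    have ge: "snd (B i) \<le> y" using p ij seg[of p "T i" "B i"] l[of i] down[of i] by auto
    have le: "y \<le> snd (T j)" using q ij seg[of q "T j" "B j"] l[of j] down[of j] by auto
    have "k = 0" "y = snd (B i)" using order[of i k] k ij ge le by auto
    then have BT: "B i = T j" using link[of i] k ij by simp
    have "p = B i"
      using p ij seg[of p "T i" "B i" "B i"] l[of i] down[of i] \<open>y = snd (B i)\<close> by auto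
    moreover have "q = T j"
      using q ij seg[of q "T j" "B j" "T j"] l[of j] down[of j] \<open>y = snd (B i)\<close> BT by auto
    ultimately show ?thesis using BT by simp
  qed
  have "x = x'" if xx': "(x, y) \<in> \<Z>" "(x', y) \<in> \<Z>" for x x'
  proof -
    obtain i j where "i \<in> {1..n}" "j \<in> {1..n}" "(x, y) \<in> l i" "(x', y) \<in> l j"
      using xx' by (auto simp: \<Z>)
    then show ?thesis
      using uniq[of "(x, y)" i "(x', y)" j] uniq[of "(x', y)" j "(x, y)" i]
      by (cases "i \<le> j") auto
  qed
  with ex show ?thesis by blast
qed

definition zigzag_x :: "(real \<times> real) set \<Rightarrow> real \<Rightarrow> real" where
  "zigzag_x \<Z> y = (THE x. (x, y) \<in> \<Z>)"

text \<open>The right-hand bound is the abscissa, at height \<open>y\<close>, of the image of \<open>\<Z>\<close> under the shift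
  \<open>(x, y) \<mapsto> (x + pi, - y)\<close>.\<close>

definition Ind_C :: "(real \<times> real) set \<Rightarrow> (real \<times> real) set" where
  "Ind_C \<Z> = {(x, y). (x, y) \<in> Ind_D \<and> zigzag_x \<Z> y \<le> x \<and> x \<le> zigzag_x \<Z> (- y) + pi}"

text \<open>The surface integral is the Lebesgue integral with respect to area; that it yields a real
  number means that the function is Lebesgue integrable on the rectangle.\<close>

definition permissible :: "(object \<Rightarrow> real) \<Rightarrow> bool" where
  "permissible c \<longleftrightarrow> c None = 0 \<and>
     (\<forall>X Y W Z. tilting_rectangle X Y W Z \<longrightarrow>
        set_integrable lebesgue (convex hull {X, Y, W, Z}) (\<lambda>p. c (object_of p)))"

definition rectangle_integral ::
  "(object \<Rightarrow> real) \<Rightarrow> real \<times> real \<Rightarrow> real \<times> real \<Rightarrow> real \<times> real \<Rightarrow> real \<times> real \<Rightarrow> real" where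
  "rectangle_integral c X Y W Z =
     (LINT p:convex hull {X, Y, W, Z}|lebesgue. c (object_of p))"

definition solution :: "(object \<Rightarrow> real) \<Rightarrow> (real \<times> real) set \<Rightarrow> (object \<Rightarrow> real) \<Rightarrow> bool" where
  "solution c \<Z> \<Phi> \<longleftrightarrow> \<Phi> None = 0 \<and>
     (\<forall>X Y W Z. tilting_rectangle X Y W Z \<longrightarrow>
        \<Phi> (object_of X) + \<Phi> (object_of W) =
          \<Phi> (object_of Y) + \<Phi> (object_of Z) + rectangle_integral c X Y W Z) \<and>
     (\<forall>X\<in>Ind_C \<Z>. 0 \<le> \<Phi> (object_of X))"

text \<open>The product of copies of the reals indexed by \<open>I\<close> is encoded as an extensional function
  space, whose elements are \<open>undefined\<close> outside \<open>I\<close>. It is not a linear subspace of the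
  type of all functions, but it is closed under convex combinations: their value at an outside
  point is \<open>u * undefined + v * undefined = undefined\<close> since \<open>u + v = 1\<close>. Thus line segments and
  convexity in the function type coincide with those in the product.\<close>

definition real_product :: "(real \<times> real) set \<Rightarrow> (real \<times> real \<Rightarrow> real) set" where
  "real_product I = I \<rightarrow>\<^sub>E UNIV"

definition continuous_associahedron ::
  "(real \<times> real) set \<Rightarrow> (object \<Rightarrow> real) \<Rightarrow> (real \<times> real \<Rightarrow> real) set" where
  "continuous_associahedron \<Z> c = {\<lambda>X\<in>Ind_C \<Z>. \<Phi> (object_of X) | \<Phi>. solution c \<Z> \<Phi>}"

end

theory Submission imports Defs begin

text \<open>All conditions defining a solution with respect to a fixed \<open>c\<close> are affine equations or linear
  inequalities in the values of \<open>\<Phi>\<close>: the surface integral of \<open>c\<close> does not involve \<open>\<Phi>\<close>, so it is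
  the constant term of a mesh relation and survives a combination \<open>u\<Phi> + v\<Psi>\<close> because \<open>u + v = 1\<close>,
  while \<open>\<Phi> \<ge> 0\<close> survives because \<open>u, v \<ge> 0\<close>. Hence solutions are closed under convex combinations
  (\<open>solution_convex_combination\<close>), and the associahedron, their image under restriction to the
  objects of the zigzag category, inherits convexity.\<close>

lemma solution_convex_combination:
  assumes \<Phi>: "solution c \<Z> \<Phi>" and \<Psi>: "solution c \<Z> \<Psi>"
    and uv: "0 \<le> u" "0 \<le> v" "u + v = 1"
  shows "solution c \<Z> (\<lambda>A. u * \<Phi> A + v * \<Psi> A)"
  unfolding solution_def
proof (intro conjI allI impI ballI)
  show "u * \<Phi> None + v * \<Psi> None = 0"
    using \<Phi> \<Psi> by (simp add: solution_def)
next
  fix X Y W Z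
  assume R: "tilting_rectangle X Y W Z"
  let ?I = "rectangle_integral c X Y W Z"
  have "\<Phi> (object_of X) + \<Phi> (object_of W) = \<Phi> (object_of Y) + \<Phi> (object_of Z) + ?I"
    and "\<Psi> (object_of X) + \<Psi> (object_of W) = \<Psi> (object_of Y) + \<Psi> (object_of Z) + ?I"
    using \<Phi> \<Psi> R unfolding solution_def by blast+
  then have "u * (\<Phi> (object_of X) + \<Phi> (object_of W)) + v * (\<Psi> (object_of X) + \<Psi> (object_of W)) =
      u * (\<Phi> (object_of Y) + \<Phi> (object_of Z)) + v * (\<Psi> (object_of Y) + \<Psi> (object_of Z))
        + (u + v) * ?I"
    by (simp add: algebra_simps)
  then show "u * \<Phi> (object_of X) + v * \<Psi> (object_of X)
      + (u * \<Phi> (object_of W) + v * \<Psi> (object_of W)) =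
      u * \<Phi> (object_of Y) + v * \<Psi> (object_of Y)
      + (u * \<Phi> (object_of Z) + v * \<Psi> (object_of Z)) + ?I"
    unfolding uv(3) by (simp add: algebra_simps)
next
  fix X
  assume "X \<in> Ind_C \<Z>"
  then show "0 \<le> u * \<Phi> (object_of X) + v * \<Psi> (object_of X)"
    using \<Phi> \<Psi> uv by (simp add: solution_def)
qed

text \<open>The coordinates outside \<open>I\<close>, all equal to \<open>undefined\<close>, are the reason for \<open>u + v = 1\<close>.\<close>

lemma restrict_convex_combination:
  fixes f g :: "'a \<Rightarrow> real"
  assumes "u + v = 1"
  shows "u *\<^sub>R restrict f I + v *\<^sub>R restrict g I = (\<lambda>X\<in>I. u * f X + v * g X)"
proof
  fix X
  have "u * (undefined::real) + v * undefined = undefined"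
    using assms by (metis distrib_right mult_1)
  then show "(u *\<^sub>R restrict f I + v *\<^sub>R restrict g I) X = (\<lambda>X\<in>I. u * f X + v * g X) X"
    by (simp add: scaleR_fun_def)
qed

theorem theorem1:
  fixes \<Z> :: "(real \<times> real) set" and c :: "object \<Rightarrow> real"
  assumes "zigzag \<Z>"
    and "permissible c"
    and "\<And>X. X \<in> Ind_C \<Z> \<Longrightarrow> 0 < c (object_of X)"
  shows "continuous_associahedron \<Z> c \<subseteq> real_product (Ind_C \<Z>)
    \<and> convex (continuous_associahedron \<Z> c)"
proof
  show "continuous_associahedron \<Z> c \<subseteq> real_product (Ind_C \<Z>)"
    by (auto simp: continuous_associahedron_def real_product_def)
  show "convex (continuous_associahedron \<Z> c)"
  proof (rule convexI)
    fix p q and u v :: real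
    assume uv: "0 \<le> u" "0 \<le> v" "u + v = 1"
      and "p \<in> continuous_associahedron \<Z> c" "q \<in> continuous_associahedron \<Z> c"
    then obtain \<Phi> \<Psi> where sol: "solution c \<Z> \<Phi>" "solution c \<Z> \<Psi>"
      and p: "p = (\<lambda>X\<in>Ind_C \<Z>. \<Phi> (object_of X))"
      and q: "q = (\<lambda>X\<in>Ind_C \<Z>. \<Psi> (object_of X))"
      by (auto simp: continuous_associahedron_def)
    have "u *\<^sub>R p + v *\<^sub>R q = (\<lambda>X\<in>Ind_C \<Z>. u * \<Phi> (object_of X) + v * \<Psi> (object_of X))"
      unfolding p q by (rule restrict_convex_combination[OF uv(3)])
    then show "u *\<^sub>R p + v *\<^sub>R q \<in> continuous_associahedron \<Z> c"
      using solution_convex_combination[OF sol uv]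
      unfolding continuous_associahedron_def
      by (intro CollectI exI[of _ "\<lambda>A. u * \<Phi> A + v * \<Psi> A"]) simp
  qed
qed

end
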